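(* Let $G$ be a complete $k$-partite graph on $n$ vertices $\{x_1,\ldots,x_n\}$, let $\mathbb{K}$ be a field and $R=\mathbb{K}[x_1,\ldots,x_n]$. Then $\beta_{i,\mathbf{a}}^R(R/I(G))\le k-1$ for all $i\ge 1$ and $\mathbf{a}\in\mathbb{N}^n$.
   Context: A complete $k$-partite graph has vertex set partitioned into $k$ non-empty parts $V_1\sqcup\cdots\sqcup V_k$, with two vertices adjacent if and only if they lie in different parts. $I(G)=(x_ix_j:\{x_i,x_j\}\in E(G))\subset R$ is the edge ideal. $R$ is $\mathbb{N}^n$-graded with $\deg x_i$ the $i$-th standard basis vector, and $\beta_{i,\mathbf{a}}^R$ are the multigraded Betti numbers. *)

theory Defs
  imports Complex_Main "HOL-Library.Poly_Mapping" "HOL-Library.Disjoint_Sets"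
begin

text \<open>
  Polynomials over \<open>'k\<close> in variables indexed by the finite type \<open>'v\<close> are finitely supported
  functions on monomials; a monomial is its own exponent vector, so \<open>'v mon\<close> also serves as
  the monoid of multidegrees.
\<close>

type_synonym 'v mon = "'v \<Rightarrow>\<^sub>0 nat"
type_synonym ('v, 'k) mpoly = "'v mon \<Rightarrow>\<^sub>0 'k"

definition var :: "'v \<Rightarrow> ('v, 'k::comm_ring_1) mpoly" where
  "var v = Poly_Mapping.single (Poly_Mapping.single v 1) 1"

interpretation ideal: module "(*) :: 'a::comm_ring_1 \<Rightarrow> 'a \<Rightarrow> 'a"
  by standard (simp_all add: algebra_simps)

definition irrelevant_ideal :: "('v, 'k::comm_ring_1) mpoly set" where
  "irrelevant_ideal = ideal.span (range var)"

definition complete_multipartite :: "nat \<Rightarrow> 'v set set \<Rightarrow> bool" where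
  "complete_multipartite k E \<longleftrightarrow>
     (\<exists>P. partition_on (UNIV :: 'v set) P \<and> card P = k \<and>
          E = {{u, v} | u v. \<exists>U\<in>P. \<exists>V\<in>P. u \<in> U \<and> v \<in> V \<and> U \<noteq> V})"

definition edge_ideal :: "'v set set \<Rightarrow> ('v, 'k::comm_ring_1) mpoly set" where
  "edge_ideal E = ideal.span {var u * var v | u v. {u, v} \<in> E}"


text \<open>
  The data of a multigraded complex of finitely generated free modules augmented towards
  \<open>R/I\<close>. In homological degree \<open>i\<close> the module is the direct sum of \<open>R(-shift i p)\<close>
  over \<open>p < rnk i\<close>. The matrix \<open>dmat i\<close>, with rows \<open>p < rnk i\<close> and columns \<open>q < rnk (Suc i)\<close>,
  is the differential from degree \<open>Suc i\<close> to degree \<open>i\<close>, and \<open>aug p\<close> is a representative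
  in \<open>R\<close> of the image in \<open>R/I\<close> of the \<open>p\<close>-th basis element in degree \<open>0\<close>. Entries outside
  these ranges are ignored.
\<close>

record (overloaded) ('v, 'k::zero) free_complex =
  rnk :: "nat \<Rightarrow> nat"
  shift :: "nat \<Rightarrow> nat \<Rightarrow> 'v mon"
  aug :: "nat \<Rightarrow> ('v, 'k) mpoly"
  dmat :: "nat \<Rightarrow> nat \<Rightarrow> nat \<Rightarrow> ('v, 'k) mpoly"

definition chains :: "('v, 'k::comm_ring_1) free_complex \<Rightarrow> nat \<Rightarrow> (nat \<Rightarrow> ('v, 'k) mpoly) set" where
  "chains F i = {c. \<forall>p \<ge> rnk F i. c p = 0}"

definition boundary ::
  "('v, 'k::comm_ring_1) free_complex \<Rightarrow> nat \<Rightarrow> (nat \<Rightarrow> ('v, 'k) mpoly) \<Rightarrow> nat \<Rightarrow> ('v, 'k) mpoly" where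
  "boundary F i c = (\<lambda>p. if p < rnk F i then \<Sum>q<rnk F (Suc i). dmat F i p q * c q else 0)"

definition augment :: "('v, 'k::comm_ring_1) free_complex \<Rightarrow> (nat \<Rightarrow> ('v, 'k) mpoly) \<Rightarrow> ('v, 'k) mpoly" where
  "augment F c = (\<Sum>p<rnk F 0. aug F p * c p)"

text \<open>All maps preserve multidegrees; the entries may be zero.\<close>

definition multigraded :: "('v, 'k::comm_ring_1) free_complex \<Rightarrow> bool" where
  "multigraded F \<longleftrightarrow>
     (\<forall>p < rnk F 0. Poly_Mapping.keys (aug F p) \<subseteq> {shift F 0 p}) \<and>
     (\<forall>i. \<forall>p < rnk F i. \<forall>q < rnk F (Suc i).
        \<forall>m \<in> Poly_Mapping.keys (dmat F i p q). m + shift F i p = shift F (Suc i) q)"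

definition resolves_quotient ::
  "('v, 'k::comm_ring_1) free_complex \<Rightarrow> ('v, 'k) mpoly set \<Rightarrow> bool" where
  "resolves_quotient F I \<longleftrightarrow>
     (\<forall>f. \<exists>c \<in> chains F 0. f - augment F c \<in> I) \<and>
     {c \<in> chains F 0. augment F c \<in> I} = boundary F 0 ` chains F 1 \<and>
     (\<forall>i. {c \<in> chains F (Suc i). boundary F i c = (\<lambda>_. 0)}
          = boundary F (Suc i) ` chains F (Suc (Suc i)))"

definition minimal_complex :: "('v, 'k::comm_ring_1) free_complex \<Rightarrow> bool" where
  "minimal_complex F \<longleftrightarrow>
     (\<forall>i. \<forall>p < rnk F i. \<forall>q < rnk F (Suc i). dmat F i p q \<in> irrelevant_ideal)"

definition minimal_multigraded_resolution ::
  "('v, 'k::comm_ring_1) free_complex \<Rightarrow> ('v, 'k) mpoly set \<Rightarrow> bool" where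
  "minimal_multigraded_resolution F I \<longleftrightarrow>
     multigraded F \<and> resolves_quotient F I \<and> minimal_complex F"

text \<open>
  The multigraded Betti number is the number of summands \<open>R(-a)\<close> in homological degree \<open>i\<close>
  of a minimal multigraded free resolution; it is the same for every such resolution of a
  given module.
\<close>

definition multigraded_betti :: "('v, 'k::comm_ring_1) free_complex \<Rightarrow> nat \<Rightarrow> 'v mon \<Rightarrow> nat" where
  "multigraded_betti F i a = card {p. p < rnk F i \<and> shift F i p = a}"

end

theory Submission
  imports Defs "HOL-Library.Function_Algebras"
begin

text \<open>
  Let \<open>t i J b\<close> be the dimension of \<open>Tor\<^sub>i(R/I, R/(J))\<close> in degree \<open>b\<close>, for a set \<open>J\<close> of variables.
  With \<open>J\<close> the support of \<open>a\<close>, minimality of \<open>F\<close> makes this the Betti number in degree \<open>a\<close>.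
  Multiplication by a variable \<open>v\<close> gives \<open>t i (J \<union> {v}) b \<le> t i J b + t (i - 1) J (b - v)\<close>,
  while \<open>t i {v} b\<close> is at most \<open>1\<close>, and \<open>0\<close> unless \<open>x\<^sup>b \<in> I\<close> and \<open>x\<^sup>b\<^sup>-\<^sup>v \<notin> I\<close>.
  So, for any \<open>v \<in> J\<close>, \<open>t i J b\<close> is at most the number of \<open>T \<subseteq> J - {v}\<close> such that \<open>x\<^sup>b\<^sup>-\<^sup>T \<in> I\<close> and
  \<open>x\<^sup>b\<^sup>-\<^sup>T\<^sup>-\<^sup>v \<notin> I\<close>. Choose one vertex from each part met by \<open>a\<close>, and let \<open>J\<close> be the set of these
  \<open>s \<le> k\<close> vertices. If \<open>b\<close> exceeds the indicator of \<open>J\<close> at some \<open>u\<close>, taking for \<open>v\<close> the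
  representative of the part of \<open>u\<close> makes the count \<open>0\<close>; if \<open>b\<close> is that indicator, then
  \<open>T = J - {v, w}\<close> for some \<open>w\<close>, so the count is at most \<open>s - 1\<close>. Adjoining the remaining variables,
  only one summand is nonzero.
\<close>

text \<open>As a simplification rule this fact loops with \<open>mult.assoc\<close>.\<close>

declare ideal.scale_scale [simp del]

section \<open>The monomial ideal\<close>

lemma lookup_single_times:
  fixes f :: "('v, 'k::comm_ring_1) mpoly"
  shows "poly_mapping.lookup (Poly_Mapping.single m x * f) k =
    (if poly_mapping.lookup m \<le> poly_mapping.lookup k then x * poly_mapping.lookup f (k - m) else 0)"
proof (cases "poly_mapping.lookup m \<le> poly_mapping.lookup k")
  case True
  then have k: "k = m + (k - m)"
    by (intro poly_mapping_eqI) (simp add: lookup_add lookup_minus le_fun_def)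
  have "poly_mapping.lookup (Poly_Mapping.single m x * f) (m + t) = x * poly_mapping.lookup f t" for t
    by (simp add: lookup_mult lookup_single when_mult)
  then have "poly_mapping.lookup (Poly_Mapping.single m x * f) k = x * poly_mapping.lookup f (k - m)"
    using k by metis
  then show ?thesis using True by simp
next
  case False
  have "k \<notin> Poly_Mapping.keys (Poly_Mapping.single m x * f)"
  proof
    assume "k \<in> Poly_Mapping.keys (Poly_Mapping.single m x * f)"
    then obtain t where "k = m + t"
      using keys_mult[of "Poly_Mapping.single m x" f] by (auto split: if_splits)
    then show False using False by (auto simp: lookup_add le_fun_def)
  qed
  then show ?thesis using False by (simp add: in_keys_iff)
qed

text \<open>Polynomials without constant term form an ideal containing every variable. This turns
  minimality into the absence of constant terms in the differentials.\<close>

lemma lookup_irrelevant_ideal: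
  assumes "f \<in> (irrelevant_ideal :: ('v, 'k::comm_ring_1) mpoly set)"
  shows "poly_mapping.lookup f 0 = 0"
proof -
  have "ideal.span (range var) \<subseteq> {f :: ('v, 'k) mpoly. 0 \<notin> Poly_Mapping.keys f}"
  proof (rule ideal.span_minimal)
    have "Poly_Mapping.single v 1 \<noteq> (0::'v mon)" for v
      by (metis lookup_single_eq lookup_zero zero_neq_one)
    then show "range var \<subseteq> {f :: ('v, 'k) mpoly. 0 \<notin> Poly_Mapping.keys f}"
      by (auto simp: var_def)
    have "0 \<notin> Poly_Mapping.keys (c * f)" if "0 \<notin> Poly_Mapping.keys f" for c f :: "('v, 'k) mpoly"
    proof
      assume "0 \<in> Poly_Mapping.keys (c * f)"
      then obtain s t where st: "0 = s + t" "t \<in> Poly_Mapping.keys f"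
        using keys_mult[of c f] by auto
      have "poly_mapping.lookup t v = 0" for v
        using arg_cong[OF st(1), of "\<lambda>m. poly_mapping.lookup m v"] by (simp add: lookup_add)
      then have "t = 0" by (intro poly_mapping_eqI) simp
      then show False using st(2) that by simp
    qed
    then show "ideal.subspace {f :: ('v, 'k) mpoly. 0 \<notin> Poly_Mapping.keys f}"
      by (auto simp: ideal.subspace_def in_keys_iff lookup_add)
  qed
  then show ?thesis using assms by (auto simp: irrelevant_ideal_def in_keys_iff)
qed

definition edge_degree :: "'v set set \<Rightarrow> ('v \<Rightarrow> nat) \<Rightarrow> bool" where
  "edge_degree E b \<longleftrightarrow>
     (\<exists>u v. {u, v} \<in> E \<and> poly_mapping.lookup (Poly_Mapping.single u 1 + Poly_Mapping.single v 1) \<le> b)"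

lemma edge_degree_mono: "edge_degree E b \<Longrightarrow> b \<le> b' \<Longrightarrow> edge_degree E b'"
  unfolding edge_degree_def using order_trans by blast

text \<open>The polynomials whose monomials are all multiples of generators form an ideal, and
  conversely each such monomial is itself in the ideal. Membership thus becomes a condition on
  exponents.\<close>

lemma mem_edge_ideal_iff:
  fixes f :: "('v, 'k::comm_ring_1) mpoly"
  shows "f \<in> edge_ideal E \<longleftrightarrow> (\<forall>m \<in> Poly_Mapping.keys f. edge_degree E (poly_mapping.lookup m))"
proof
  let ?A = "{f :: ('v, 'k) mpoly. \<forall>m \<in> Poly_Mapping.keys f. edge_degree E (poly_mapping.lookup m)}"
  have "ideal.span {var u * var v | u v. {u, v} \<in> E} \<subseteq> ?A"
  proof (rule ideal.span_minimal)
    show "{var u * var v | u v. {u, v} \<in> E} \<subseteq> ?A"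
    proof safe
      fix u v m assume uv: "{u, v} \<in> E" "m \<in> Poly_Mapping.keys (var u * var v :: ('v, 'k) mpoly)"
      then have "m = Poly_Mapping.single u 1 + Poly_Mapping.single v 1"
        by (simp add: var_def mult_single)
      then show "edge_degree E (poly_mapping.lookup m)" using uv(1) unfolding edge_degree_def by (intro exI[of _ u] exI[of _ v]) simp
    qed
    have "c * f \<in> ?A" if "f \<in> ?A" for c f :: "('v, 'k) mpoly"
    proof safe
      fix m assume "m \<in> Poly_Mapping.keys (c * f)"
      then obtain s t where st: "m = s + t" "t \<in> Poly_Mapping.keys f"
        using keys_mult[of c f] by auto
      have "poly_mapping.lookup t \<le> poly_mapping.lookup m" using st(1) by (simp add: lookup_add le_fun_def)
      then show "edge_degree E (poly_mapping.lookup m)" using st(2) that edge_degree_mono by blast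
    qed
    moreover have "f + g \<in> ?A" if "f \<in> ?A" "g \<in> ?A" for f g :: "('v, 'k) mpoly"
      using that keys_add[of f g] by blast
    moreover have "0 \<in> ?A" by simp
    ultimately show "ideal.subspace ?A" unfolding ideal.subspace_def by blast
  qed
  then show "\<forall>m \<in> Poly_Mapping.keys f. edge_degree E (poly_mapping.lookup m)" if "f \<in> edge_ideal E"
    using that unfolding edge_ideal_def by blast
next
  assume keys: "\<forall>m \<in> Poly_Mapping.keys f. edge_degree E (poly_mapping.lookup m)"
  have "Poly_Mapping.single m c \<in> edge_ideal E" if "edge_degree E (poly_mapping.lookup m)" for m and c :: 'k
  proof -
    obtain u v where uv: "{u, v} \<in> E"
        "poly_mapping.lookup (Poly_Mapping.single u 1 + Poly_Mapping.single v 1) \<le> poly_mapping.lookup m"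
      using \<open>edge_degree E (poly_mapping.lookup m)\<close> unfolding edge_degree_def by blast
    let ?uv = "Poly_Mapping.single u 1 + Poly_Mapping.single v 1"
    have "m = (m - ?uv) + ?uv"
      using uv(2) by (intro poly_mapping_eqI) (simp add: lookup_add lookup_minus le_fun_def)
    then have eq: "Poly_Mapping.single m c = Poly_Mapping.single (m - ?uv) c * (var u * var v)"
      unfolding var_def mult_single by simp
    show ?thesis
      unfolding edge_ideal_def eq
      using uv(1) by (intro ideal.span_scale[OF ideal.span_base]) blast
  qed
  then have "(\<Sum>m\<in>Poly_Mapping.keys f. Poly_Mapping.single m (poly_mapping.lookup f m)) \<in> edge_ideal E"
    using keys unfolding edge_ideal_def by (intro ideal.span_sum) auto
  moreover have "(\<Sum>m\<in>Poly_Mapping.keys f. Poly_Mapping.single m (poly_mapping.lookup f m)) = f"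
    by (intro poly_mapping_eqI)
      (auto simp: lookup_sum lookup_single when_def in_keys_iff sum.delta)
  ultimately show "f \<in> edge_ideal E" by simp
qed

section \<open>Strands relative to a set of variables\<close>

text \<open>Modulo the span of \<open>B\<close>, a subspace of a space with \<open>card S\<close>
  generators needs at most as many; taking them inside \<open>Z\<close> avoids quotient spaces. If
  \<open>Z\<close> is not yet inside \<open>span (S \<union> B)\<close>, one \<open>z\<close> in
  \<open>Z\<close> with nonzero coefficient at \<open>x\<close> clears that coefficient from all of
  \<open>Z\<close>.\<close>

lemma (in vector_space) subspace_span_generators:
  assumes "finite S" "subspace Z" "Z \<subseteq> span (S \<union> B)"
  shows "\<exists>S'. finite S' \<and> card S' \<le> card S \<and> S' \<subseteq> Z \<and> Z \<subseteq> span (S' \<union> B)"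
  using assms
proof (induction S arbitrary: Z rule: finite_induct)
  case empty
  then show ?case by (intro exI[of _ "{}"]) auto
next
  case (insert x S)
  let ?Z0 = "Z \<inter> span (S \<union> B)"
  have "subspace ?Z0"
    using insert.prems(1) subspace_inter subspace_span by blast
  then obtain S0 where S0: "finite S0" "card S0 \<le> card S" "S0 \<subseteq> ?Z0" "?Z0 \<subseteq> span (S0 \<union> B)"
    using insert.IH[of ?Z0] by blast
  show ?case
  proof (cases "Z \<subseteq> span (S \<union> B)")
    case True
    then show ?thesis using S0 insert.hyps
      by (intro exI[of _ S0]) auto
  next
    case False
    then obtain z where z: "z \<in> Z" "z \<notin> span (S \<union> B)" by blast
    have "z \<in> span (insert x (S \<union> B))" using z insert.prems(2) by auto
    then obtain l where l: "z - l *s x \<in> span (S \<union> B)" by (auto simp: span_breakdown_eq)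
    have l0: "l \<noteq> 0" using l z(2) by auto
    have "y \<in> span (insert z S0 \<union> B)" if y: "y \<in> Z" for y
    proof -
      have "y \<in> span (insert x (S \<union> B))" using y insert.prems(2) by auto
      then obtain m where m: "y - m *s x \<in> span (S \<union> B)" by (auto simp: span_breakdown_eq)
      have eq: "y - (m / l) *s z = (y - m *s x) - (m / l) *s (z - l *s x)"
        using l0 by (simp add: scale_right_diff_distrib)
      have "y - (m / l) *s z \<in> span (S \<union> B)"
        unfolding eq by (intro span_diff span_scale l m)
      moreover have "y - (m / l) *s z \<in> Z"
        using y z(1) insert.prems(1) by (intro subspace_diff subspace_scale)
      ultimately have "y - (m / l) *s z \<in> span (S0 \<union> B)" using S0(4) by blast
      then show ?thesis by (auto simp: span_breakdown_eq)
    qed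
    then show ?thesis using S0 z insert.hyps
      by (intro exI[of _ "insert z S0"]) (auto simp: card_insert_if)
  qed
qed

global_interpretation fun_space: vector_space "\<lambda>(a::'k::field) (c::nat \<Rightarrow> 'k) p. a * c p"
  by unfold_locales (simp_all add: fun_eq_iff algebra_simps)

definition supported :: "nat set \<Rightarrow> (nat \<Rightarrow> 'k::zero) set" where
  "supported X = {c. \<forall>p. p \<notin> X \<longrightarrow> c p = 0}"

definition lower :: "('v \<Rightarrow> nat) \<Rightarrow> 'v set \<Rightarrow> 'v \<Rightarrow> nat" where
  "lower b T = (\<lambda>x. if x \<in> T then b x - 1 else b x)"

text \<open>
  The degree-\<open>b\<close> part of a multigraded free module is the vector space on those basis elements
  \<open>p\<close> with \<open>sh i p \<le> b\<close>; in these coordinates the differential is the scalar matrix \<open>D i\<close>, which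
  does not depend on \<open>b\<close>, and the augmentation is \<open>\<alpha>\<close>.
\<close>

locale multigraded_strands =
  fixes r :: "nat \<Rightarrow> nat"
    and sh :: "nat \<Rightarrow> nat \<Rightarrow> 'v \<Rightarrow> nat"
    and D :: "nat \<Rightarrow> nat \<Rightarrow> nat \<Rightarrow> 'k::field"
    and \<alpha> :: "nat \<Rightarrow> 'k"
begin

definition basis :: "('v \<Rightarrow> nat) \<Rightarrow> nat \<Rightarrow> nat set" where
  "basis b i = {p. p < r i \<and> sh i p \<le> b}"

text \<open>
  For \<open>J\<close> inside the support of \<open>b\<close>, \<open>lower_basis J b i\<close> spans the degree-\<open>b\<close> part of the submodule
  generated by the variables in \<open>J\<close>. Hence \<open>degree_bound i J b n\<close> below says that
  \<open>Tor\<close> of \<open>R/I\<close> and \<open>R/(J)\<close> has dimension at most \<open>n\<close> in homological degree \<open>i\<close> and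
  multidegree \<open>b\<close>.
\<close>

definition lower_basis :: "'v set \<Rightarrow> ('v \<Rightarrow> nat) \<Rightarrow> nat \<Rightarrow> nat set" where
  "lower_basis J b i = {p \<in> basis b i. \<exists>v\<in>J. sh i p v < b v}"

definition d :: "nat \<Rightarrow> (nat \<Rightarrow> 'k) \<Rightarrow> nat \<Rightarrow> 'k" where
  "d i c = (\<lambda>p. if p < r i then \<Sum>q<r (Suc i). D i p q * c q else 0)"

text \<open>Indexed by the source and zero out of degree \<open>0\<close>, so that
  \<open>rel_cycles\<close> covers degree \<open>0\<close> as well. The augmentation stays outside,
  since Tor is computed from the complex alone.\<close>

primrec bd :: "nat \<Rightarrow> (nat \<Rightarrow> 'k) \<Rightarrow> nat \<Rightarrow> 'k" where
  "bd 0 c = (\<lambda>_. 0)"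
| "bd (Suc i) c = d i c"

definition eps :: "(nat \<Rightarrow> 'k) \<Rightarrow> 'k" where
  "eps c = (\<Sum>p<r 0. \<alpha> p * c p)"

text \<open>The preimage in the full strand of the cycles of its quotient by
  \<open>lower_basis\<close>; with \<open>rel_boundaries\<close> it gives the homology of the
  quotient without forming it.\<close>

definition rel_cycles :: "nat \<Rightarrow> 'v set \<Rightarrow> ('v \<Rightarrow> nat) \<Rightarrow> (nat \<Rightarrow> 'k) set" where
  "rel_cycles i J b = {c \<in> supported (basis b i). bd i c \<in> supported (lower_basis J b (i - 1))}"

definition rel_boundaries :: "nat \<Rightarrow> 'v set \<Rightarrow> ('v \<Rightarrow> nat) \<Rightarrow> (nat \<Rightarrow> 'k) set" where
  "rel_boundaries i J b =
     {d i y + u | y u. y \<in> supported (basis b (Suc i)) \<and> u \<in> supported (lower_basis J b i)}"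

definition degree_bound :: "nat \<Rightarrow> 'v set \<Rightarrow> ('v \<Rightarrow> nat) \<Rightarrow> nat \<Rightarrow> bool" where
  "degree_bound i J b n \<longleftrightarrow>
     (\<exists>S. finite S \<and> card S \<le> n \<and> rel_cycles i J b \<subseteq> fun_space.span (S \<union> rel_boundaries i J b))"

text \<open>One bound serves all homological degrees, since adjoining a variable involves both
  \<open>i\<close> and \<open>i - 1\<close>.\<close>

definition hom_bound :: "'v set \<Rightarrow> ('v \<Rightarrow> nat) \<Rightarrow> nat \<Rightarrow> bool" where
  "hom_bound J b n \<longleftrightarrow> (\<forall>i. degree_bound i J b n)"

lemma d_add: "d i (c + c') = d i c + d i c'"
  and d_diff: "d i (c - c') = d i c - d i c'"
  by (auto simp: d_def fun_eq_iff algebra_simps sum.distrib sum_subtractf)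

lemma d_scale: "d i (\<lambda>p. a * c p) = (\<lambda>p. a * d i c p)"
  by (rule ext) (simp add: d_def sum_distrib_left mult.left_commute)

lemma bd_add: "bd i (c + c') = bd i c + bd i c'"
  by (cases i) (simp_all add: d_add fun_eq_iff)

lemma bd_diff: "bd i (c - c') = bd i c - bd i c'"
  by (cases i) (simp_all add: d_diff fun_eq_iff)

lemma bd_scale: "bd i (\<lambda>p. a * c p) = (\<lambda>p. a * bd i c p)"
  by (cases i) (simp_all add: d_scale fun_eq_iff)

lemma eps_diff: "eps (c - c') = eps c - eps c'"
  by (simp add: eps_def right_diff_distrib sum_subtractf)

lemma eps_scale: "eps (\<lambda>p. a * c p) = a * eps c"
  by (simp add: eps_def sum_distrib_left mult.left_commute)

lemma supported_mono: "X \<subseteq> Y \<Longrightarrow> supported X \<subseteq> supported Y"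
  by (auto simp: supported_def)

lemma supported_add: "x \<in> supported X \<Longrightarrow> y \<in> supported X \<Longrightarrow> x + (y::nat \<Rightarrow> 'k) \<in> supported X"
  and supported_diff: "x \<in> supported X \<Longrightarrow> y \<in> supported X \<Longrightarrow> x - (y::nat \<Rightarrow> 'k) \<in> supported X"
  and supported_scale: "x \<in> supported X \<Longrightarrow> (\<lambda>p. a * (x p::'k)) \<in> supported X"
  by (auto simp: supported_def)

lemma lower_basis_subset: "lower_basis J b i \<subseteq> basis b i"
  by (auto simp: lower_basis_def)

lemma subspace_rel_cycles: "fun_space.subspace (rel_cycles i J b)"
  unfolding fun_space.subspace_def rel_cycles_def
  by (auto simp: bd_add bd_scale intro!: supported_add supported_scale)
    (cases i; auto simp: supported_def d_def)+

lemma basis_lower: "b v > 0 \<Longrightarrow> basis (lower b {v}) i = {p \<in> basis b i. sh i p v < b v}"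
  by (force simp: basis_def lower_def le_fun_def)

lemma lower_basis_insert:
  "b v > 0 \<Longrightarrow> lower_basis (insert v J) b i = lower_basis J b i \<union> basis (lower b {v}) i"
  by (auto simp: basis_lower lower_basis_def)

text \<open>The degrees \<open>b\<close> and \<open>lower b {v}\<close> agree on \<open>J\<close>.
  The intersection says that multiplication by \<open>v\<close> is injective modulo the variables in
  \<open>J\<close>.\<close>

lemma lower_basis_lower:
  assumes "v \<notin> J" "b v > 0"
  shows "lower_basis J (lower b {v}) i = lower_basis J b i \<inter> basis (lower b {v}) i"
proof -
  have "lower b {v} w = b w" if "w \<in> J" for w
    using that assms by (auto simp: lower_def)
  then show ?thesis using assms by (auto simp: lower_basis_def basis_lower)
qed

end

text \<open>
  For the strands of a resolution of \<open>R/I\<close> by a monomial ideal \<open>I\<close>, \<open>V b\<close> says that the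
  monomial of degree \<open>b\<close> lies in \<open>I\<close>.
\<close>

locale exact_strands = multigraded_strands r sh D \<alpha>
  for r and sh :: "nat \<Rightarrow> nat \<Rightarrow> 'v \<Rightarrow> nat" and D :: "nat \<Rightarrow> nat \<Rightarrow> nat \<Rightarrow> 'k::field" and \<alpha> +
  fixes V :: "('v \<Rightarrow> nat) \<Rightarrow> bool"
  assumes sh_mono: "\<And>i p q. p < r i \<Longrightarrow> q < r (Suc i) \<Longrightarrow> D i p q \<noteq> 0 \<Longrightarrow> sh i p \<le> sh (Suc i) q"
    and exact: "\<And>i b. {c \<in> supported (basis b (Suc i)). d i c = (\<lambda>_. 0)}
                  = d (Suc i) ` supported (basis b (Suc (Suc i)))"
    and exact_eps: "\<And>b. {c \<in> supported (basis b 0). V b \<or> eps c = 0} = d 0 ` supported (basis b 1)"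
    and eps_surj: "\<And>b. \<not> V b \<Longrightarrow> \<exists>c \<in> supported (basis b 0). eps c \<noteq> 0"
    and V_mono: "\<And>b b'. V b \<Longrightarrow> b \<le> b' \<Longrightarrow> V b'"
begin

section \<open>Subcomplexes and relative homology of the strands\<close>

lemma d_supported:
  assumes "c \<in> supported (basis b (Suc i))"
  shows "d i c \<in> supported (basis b i)"
proof -
  have "d i c p = 0" if "p \<notin> basis b i" for p
  proof (cases "p < r i")
    case True
    have "D i p q * c q = 0" if q: "q < r (Suc i)" for q
    proof (rule ccontr)
      assume *: "D i p q * c q \<noteq> 0"
      then have "sh i p \<le> sh (Suc i) q" using sh_mono True q by auto
      moreover have "sh (Suc i) q \<le> b" using * assms by (auto simp: supported_def basis_def)
      ultimately have "sh i p \<le> b" by (rule order_trans)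
      then show False using True \<open>p \<notin> basis b i\<close> by (auto simp: basis_def)
    qed
    then have "(\<Sum>q<r (Suc i). D i p q * c q) = 0" by (intro sum.neutral) auto
    then show ?thesis by (simp add: d_def)
  qed (auto simp: d_def)
  then show ?thesis by (auto simp: supported_def)
qed

lemma bd_supported: "c \<in> supported (basis b i) \<Longrightarrow> bd i c \<in> supported (basis b (i - 1))"
  using d_supported by (cases i) (auto simp: supported_def)

text \<open>Nonzero matrix entries lead to smaller or equal shifts, so a variable of
  \<open>J\<close> in which \<open>q\<close> falls short of \<open>b\<close> does the same for
  \<open>p\<close>. Hence the lowered parts form a subcomplex.\<close>

lemma d_lower_supported:
  assumes c: "c \<in> supported (lower_basis J b (Suc i))"
  shows "d i c \<in> supported (lower_basis J b i)"
proof -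
  have "d i c p = 0" if p: "p \<notin> lower_basis J b i" for p
  proof (cases "p < r i")
    case True
    have "D i p q * c q = 0" if q: "q < r (Suc i)" for q
    proof (rule ccontr)
      assume *: "D i p q * c q \<noteq> 0"
      then have le: "sh i p \<le> sh (Suc i) q" using sh_mono True q by auto
      have "q \<in> lower_basis J b (Suc i)" using * c by (auto simp: supported_def)
      then obtain v where v: "v \<in> J" "sh (Suc i) q v < b v" "sh (Suc i) q \<le> b"
        by (auto simp: lower_basis_def basis_def)
      have "sh i p v < b v" using le v(2) by (meson le_fun_def order_le_less_trans)
      then show False
        using True p le v order_trans[OF le v(3)] by (auto simp: lower_basis_def basis_def)
    qed
    then have "(\<Sum>q<r (Suc i). D i p q * c q) = 0" by (intro sum.neutral) auto
    then show ?thesis by (simp add: d_def)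
  qed (auto simp: d_def)
  then show ?thesis by (auto simp: supported_def)
qed

lemma bd_lower_supported:
  "c \<in> supported (lower_basis J b i) \<Longrightarrow> bd i c \<in> supported (lower_basis J b (i - 1))"
  using d_lower_supported by (cases i) (auto simp: supported_def)

lemma bd_d:
  assumes "c \<in> supported (basis b (Suc i))"
  shows "bd i (d i c) = (\<lambda>_. 0)"
  using exact[of b] assms by (cases i) auto

lemma rel_cycle_iff:
  "c \<in> rel_cycles i J b \<longleftrightarrow> c \<in> supported (basis b i) \<and> bd i c \<in> supported (lower_basis J b (i - 1))"
  by (simp add: rel_cycles_def)

lemma rel_boundaryI:
  "y \<in> supported (basis b (Suc i)) \<Longrightarrow> u \<in> supported (lower_basis J b i) \<Longrightarrow> d i y + u \<in> rel_boundaries i J b"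
  by (auto simp: rel_boundaries_def)

lemma zero_supported: "(\<lambda>_. 0) \<in> supported X" by (simp add: supported_def)

lemma d_zero: "d i (\<lambda>_. 0) = (\<lambda>_. 0)" by (simp add: d_def fun_eq_iff)

lemma lower_rel_boundary: "u \<in> supported (lower_basis J b i) \<Longrightarrow> u \<in> rel_boundaries i J b"
  using rel_boundaryI[OF zero_supported, of u J b i] by (simp add: d_zero plus_fun_def)

lemma subspace_rel_boundaries: "fun_space.subspace (rel_boundaries i J b)"
  unfolding fun_space.subspace_def
proof (intro conjI ballI allI)
  show "0 \<in> rel_boundaries i J b"
    using lower_rel_boundary[OF zero_supported] by (simp add: zero_fun_def)
next
  fix x y assume "x \<in> rel_boundaries i J b" "y \<in> rel_boundaries i J b"
  then obtain c u c' u' where *: "x = d i c + u" "y = d i c' + u'"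
      "c \<in> supported (basis b (Suc i))" "c' \<in> supported (basis b (Suc i))"
      "u \<in> supported (lower_basis J b i)" "u' \<in> supported (lower_basis J b i)"
    by (auto simp: rel_boundaries_def)
  have "x + y = d i (c + c') + (u + u')" using * by (simp add: d_add)
  then show "x + y \<in> rel_boundaries i J b"
    using * by (metis rel_boundaryI supported_add)
next
  fix x a assume "x \<in> rel_boundaries i J b"
  then obtain c u where *: "x = d i c + u"
      "c \<in> supported (basis b (Suc i))" "u \<in> supported (lower_basis J b i)"
    by (auto simp: rel_boundaries_def)
  have "(\<lambda>p. a * x p) = d i (\<lambda>p. a * c p) + (\<lambda>p. a * u p)"
    using * by (simp add: d_scale fun_eq_iff distrib_left)
  then show "(\<lambda>p. a * x p) \<in> rel_boundaries i J b"
    using * by (auto intro!: rel_boundaryI supported_scale)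
qed

lemma rel_boundaries_insert: "rel_boundaries i J b \<subseteq> rel_boundaries i (insert v J) b"
proof -
  have "supported (lower_basis J b i) \<subseteq> (supported (lower_basis (insert v J) b i) :: (nat \<Rightarrow> 'k) set)"
    by (rule supported_mono) (auto simp: lower_basis_def)
  then show ?thesis by (auto simp: rel_boundaries_def)
qed

text \<open>
  This is the long exact sequence of \<open>0 \<longrightarrow> Q(J, b - v) \<longrightarrow> Q(J, b) \<longrightarrow> Q(J \<union> {v}, b) \<longrightarrow> 0\<close>, where
  \<open>Q(J, b)\<close> is the degree-\<open>b\<close> strand modulo the span of \<open>lower_basis J b\<close>.
\<close>

lemma degree_bound_insert:
  assumes v: "v \<notin> J" "b v > 0"
    and n1: "degree_bound i J b n1"
    and n2: "degree_bound (i - 1) J (lower b {v}) n2"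
  shows "degree_bound i (insert v J) b (n1 + n2)"
proof (cases i)
  case 0
  obtain S where S: "finite S" "card S \<le> n1" "rel_cycles 0 J b \<subseteq> fun_space.span (S \<union> rel_boundaries 0 J b)"
    using n1 0 by (auto simp: degree_bound_def)
  have "rel_cycles 0 (insert v J) b \<subseteq> rel_cycles 0 J b"
    by (auto simp: rel_cycles_def supported_def)
  also note S(3)
  also have "fun_space.span (S \<union> rel_boundaries 0 J b) \<subseteq> fun_space.span (S \<union> rel_boundaries 0 (insert v J) b)"
    by (intro fun_space.span_mono Un_mono order_refl rel_boundaries_insert)
  finally show ?thesis using S 0 unfolding degree_bound_def by (intro exI[of _ S]) auto
next
  case (Suc j)
  let ?X = "basis (lower b {v}) j"
  \<comment> \<open>\<open>L\<close> is the connecting map: it keeps the part of the boundary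
    divisible by \<open>v\<close>. For relative cycles the remainder vanishes modulo the variables
    in \<open>J\<close>.\<close>
  define L :: "(nat \<Rightarrow> 'k) \<Rightarrow> nat \<Rightarrow> 'k" where "L c = (\<lambda>p. if p \<in> ?X then d j c p else 0)" for c
  have L_diff: "L (c - c') = L c - L c'" for c c'
    by (simp add: L_def d_diff fun_eq_iff)
  have L_add: "L (c + c') = L c + L c'" for c c'
    by (simp add: L_def d_add fun_eq_iff)
  have L_scale: "L (\<lambda>p. a * c p) = (\<lambda>p. a * L c p)" for a c
    by (simp add: L_def d_scale fun_eq_iff)
  let ?Z = "rel_cycles i (insert v J) b"
  have linL: "fun_space.subspace (L ` A)" if "fun_space.subspace A" for A
    using that unfolding fun_space.subspace_def
    by (auto simp: L_add[symmetric] L_scale[symmetric] image_iff)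
      (metis L_diff diff_self)
  have rest: "d j c - L c \<in> supported (lower_basis J b j)" if "c \<in> ?Z" for c
    using that Suc v by (auto simp: rel_cycle_iff L_def supported_def lower_basis_insert)
  have L_cycle: "L c \<in> rel_cycles j J (lower b {v})" if c: "c \<in> ?Z" for c
  proof -
    have L1: "L c \<in> supported ?X" by (auto simp: L_def supported_def)
    have c': "c \<in> supported (basis b (Suc j))" using c Suc by (simp add: rel_cycle_iff)
    have "L c = d j c - (d j c - L c)" by simp
    then have "bd j (L c) = bd j (d j c) - bd j (d j c - L c)" by (metis bd_diff)
    also have "\<dots> \<in> supported (lower_basis J b (j - 1))"
      using bd_lower_supported[OF rest[OF c]] by (auto simp: bd_d[OF c'] supported_def)
    finally have "bd j (L c) \<in> supported (lower_basis J b (j - 1))" .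
    with L1 bd_supported[OF L1] show ?thesis
      using v by (auto simp: rel_cycle_iff lower_basis_lower supported_def)
  qed
  obtain S1 where S1: "finite S1" "card S1 \<le> n1"
      "rel_cycles i J b \<subseteq> fun_space.span (S1 \<union> rel_boundaries i J b)"
    using n1 by (auto simp: degree_bound_def)
  obtain S2 where S2: "finite S2" "card S2 \<le> n2"
      "rel_cycles j J (lower b {v}) \<subseteq> fun_space.span (S2 \<union> rel_boundaries j J (lower b {v}))"
    using n2 Suc by (auto simp: degree_bound_def)
  \<comment> \<open>\<open>S2\<close> generates all cycles in degree \<open>lower b {v}\<close>, but
    only elements in the image of \<open>L\<close> lift. No more generators are needed inside that
    image.\<close>
  obtain S3 where S3: "finite S3" "card S3 \<le> card S2" "S3 \<subseteq> L ` ?Z"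
      "L ` ?Z \<subseteq> fun_space.span (S3 \<union> rel_boundaries j J (lower b {v}))"
    using fun_space.subspace_span_generators[OF S2(1) linL[OF subspace_rel_cycles], of i "insert v J" b
        "rel_boundaries j J (lower b {v})"] S2(3) L_cycle by blast
  obtain S4 where S4: "S4 \<subseteq> ?Z" "finite S4" "card S4 \<le> card S3" "S3 = L ` S4"
    using S3(1,3) by (metis card_image finite_image_iff order_refl subset_image_inj)
  let ?B = "rel_boundaries i (insert v J) b"
  let ?T = "fun_space.span (S4 \<union> S1 \<union> ?B)"
  have span_image: "fun_space.span (L ` S4) \<subseteq> L ` fun_space.span S4"
    by (intro fun_space.span_minimal linL fun_space.subspace_span image_mono fun_space.span_superset)
  have S4_span: "fun_space.span S4 \<subseteq> ?Z"
    by (intro fun_space.span_minimal S4 subspace_rel_cycles)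
  \<comment> \<open>Subtract a combination \<open>s\<close> of the lifts so that
    \<open>L (c - s)\<close> is a relative boundary \<open>d j y + u\<close>. Then
    \<open>c - s - y\<close> is a relative cycle for \<open>J\<close>, handled by \<open>S1\<close>,
    while \<open>y\<close> vanishes modulo \<open>J\<close> and \<open>v\<close>.\<close>
  have "c \<in> ?T" if c: "c \<in> ?Z" for c
  proof -
    have "L c \<in> fun_space.span (L ` S4 \<union> rel_boundaries j J (lower b {v}))"
      using S3(4) c S4(4) by auto
    then obtain s t where st: "L c = L s + t" "s \<in> fun_space.span S4"
        "t \<in> rel_boundaries j J (lower b {v})"
      using span_image subspace_rel_boundaries
      by (auto simp: fun_space.span_Un fun_space.span_eq_iff[THEN iffD2])
    then obtain y u where yu: "t = d j y + u" "y \<in> supported (basis (lower b {v}) (Suc j))"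
        "u \<in> supported (lower_basis J (lower b {v}) j)"
      by (auto simp: rel_boundaries_def)
    have s: "s \<in> ?Z" using st S4_span by auto
    have cs: "c - s \<in> ?Z" using c s subspace_rel_cycles fun_space.subspace_diff by blast
    have y: "y \<in> supported (lower_basis (insert v J) b i)"
      using yu(2) v Suc by (auto simp: lower_basis_insert supported_def)
    have u: "u \<in> supported (lower_basis J b j)"
      using yu(3) v by (auto simp: lower_basis_lower supported_def)
    have "bd i (c - s - y) = (d j (c - s) - L (c - s)) + u"
      using st(1) yu(1) Suc by (simp add: d_diff d_add L_diff algebra_simps)
    also have "\<dots> \<in> supported (lower_basis J b j)"
      using rest[OF cs] u by (rule supported_add)
    finally have "c - s - y \<in> rel_cycles i J b"
      using cs y supported_mono[OF lower_basis_subset] Suc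
      by (auto simp: rel_cycle_iff intro!: supported_diff)
    then have "c - s - y \<in> fun_space.span (S1 \<union> rel_boundaries i J b)" using S1 by auto
    also have "\<dots> \<subseteq> ?T"
      using rel_boundaries_insert[of i J b v] by (intro fun_space.span_mono) auto
    finally have 1: "c - s - y \<in> ?T" .
    have 2: "s \<in> ?T" using st(2) fun_space.span_mono[of S4 "S4 \<union> S1 \<union> ?B"] by auto
    have 3: "y \<in> ?T" using lower_rel_boundary[OF y] by (intro fun_space.span_base) auto
    have "c = (c - s - y) + s + y" by simp
    then show ?thesis using 1 2 3 by (metis fun_space.span_add)
  qed
  moreover have "card (S4 \<union> S1) \<le> n1 + n2"
    using card_Un_le[of S4 S1] S1 S2 S3 S4 by linarith
  ultimately show ?thesis
    using S1(1) S4(2) unfolding degree_bound_def by (intro exI[of _ "S4 \<union> S1"]) auto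
qed

section \<open>Bounds by adjoining variables one at a time\<close>

lemma degree_bound_mono: "degree_bound i J b m \<Longrightarrow> m \<le> n \<Longrightarrow> degree_bound i J b n"
  unfolding degree_bound_def by (meson order_trans)

lemma hom_bound_mono: "hom_bound J b m \<Longrightarrow> m \<le> n \<Longrightarrow> hom_bound J b n"
  unfolding hom_bound_def using degree_bound_mono by blast

lemma degree_bound_exact:
  assumes "\<And>c. c \<in> rel_cycles i J b \<Longrightarrow> c \<in> rel_boundaries i J b"
  shows "degree_bound i J b n"
  unfolding degree_bound_def using assms
  by (intro exI[of _ "{}"]) (auto intro: fun_space.span_base)

text \<open>The long exact sequence is iterated over \<open>T\<close>. When \<open>x\<close> is
  adjoined, subsets without \<open>x\<close> come from degree \<open>b\<close> and those with
  \<open>x\<close> from degree \<open>lower b {x}\<close>.\<close>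

lemma hom_bound_Un:
  assumes "finite T" "J \<inter> T = {}" "\<And>x. x \<in> T \<Longrightarrow> b x > 0"
    and "\<And>\<tau>. \<tau> \<subseteq> T \<Longrightarrow> hom_bound J (lower b \<tau>) (f \<tau>)"
  shows "hom_bound (J \<union> T) b (sum f (Pow T))"
  using assms
proof (induction T arbitrary: b f rule: finite_induct)
  case empty
  then show ?case by (auto simp: lower_def)
next
  case (insert x T)
  have "hom_bound (J \<union> T) b (sum f (Pow T))"
    using insert.prems by (intro insert.IH) auto
  moreover have "hom_bound (J \<union> T) (lower b {x}) (\<Sum>\<tau>\<in>Pow T. f (insert x \<tau>))"
  proof (intro insert.IH)
    show "J \<inter> T = {}" using insert.prems by auto
    show "lower b {x} y > 0" if "y \<in> T" for y
      using that insert.prems(2) insert.hyps by (auto simp: lower_def)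
    show "hom_bound J (lower (lower b {x}) \<tau>) (f (insert x \<tau>))" if "\<tau> \<subseteq> T" for \<tau>
    proof -
      have "lower (lower b {x}) \<tau> = lower b (insert x \<tau>)"
        using that insert.hyps by (auto simp: lower_def fun_eq_iff)
      then show ?thesis using insert.prems(3)[of "insert x \<tau>"] that by auto
    qed
  qed
  ultimately have "hom_bound (insert x (J \<union> T)) b (sum f (Pow T) + (\<Sum>\<tau>\<in>Pow T. f (insert x \<tau>)))"
    using insert.hyps insert.prems(1,2) unfolding hom_bound_def
    by (intro allI degree_bound_insert) auto
  also have "(\<Sum>\<tau>\<in>Pow T. f (insert x \<tau>)) = sum f (insert x ` Pow T)"
    using insert.hyps by (intro sum.reindex_cong[symmetric, of "insert x"]) (auto simp: inj_on_def)
  also have "sum f (Pow T) + sum f (insert x ` Pow T) = sum f (Pow (insert x T))"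
    unfolding Pow_insert using insert.hyps by (intro sum.union_disjoint[symmetric]) auto
  finally show ?case by simp
qed

lemma lower_le: "lower b T \<le> b"
  by (auto simp: lower_def le_fun_def)

lemma basis_mono: "b \<le> b' \<Longrightarrow> basis b i \<subseteq> basis b' i"
  unfolding basis_def using order_trans by blast

text \<open>Tor with R/(v) is the homology of multiplication by \<open>v\<close> on R/I, from degree
  \<open>lower b {v}\<close> to degree \<open>b\<close>. Both spaces have dimension at most 1 and
  the map is surjective. Its kernel sits in homological degree 1 and is nonzero only if
  \<open>b\<close> is in the ideal and \<open>lower b {v}\<close> is not.\<close>

lemma hom_bound_singleton:
  assumes v: "b v > 0"
  shows "hom_bound {v} b (if V b \<and> \<not> V (lower b {v}) then 1 else 0)"
proof -
  let ?b = "lower b {v}"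
  have lb: "lower_basis {v} b i = basis ?b i" for i
    using v by (auto simp: basis_lower lower_basis_def)
  have sub: "c \<in> supported (basis b i)" if "c \<in> supported (basis ?b i)" for c :: "nat \<Rightarrow> 'k" and i
    using that supported_mono[OF basis_mono[OF lower_le]] by blast
  have bound: "c \<in> rel_boundaries i {v} b"
    if c: "c \<in> supported (basis b i)" and u: "u \<in> supported (basis ?b i)"
      and y: "y \<in> supported (basis b (Suc i))" and eq: "c = d i y + u" for c u y i
    using rel_boundaryI[OF y, of u "{v}"] u lb eq by simp
  have kernel: "c \<in> rel_boundaries (Suc i) {v} b"
    if c: "c \<in> supported (basis b (Suc i))" and u: "u \<in> supported (basis ?b (Suc i))"
      and eq: "d i c = d i u" for c u i
  proof -
    have "c - u \<in> {c \<in> supported (basis b (Suc i)). d i c = (\<lambda>_. 0)}"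
      using c sub[OF u] eq by (auto simp: d_diff intro!: supported_diff)
    then obtain y where y: "y \<in> supported (basis b (Suc (Suc i)))" "c - u = d (Suc i) y"
      unfolding exact by auto
    from y(2) have "c = d (Suc i) y + u" by (metis diff_add_cancel)
    then show ?thesis using bound[OF c u y(1)] by blast
  qed
  have "degree_bound i {v} b (if V b \<and> \<not> V ?b then 1 else 0)" for i
  proof -
    consider "i = 0" | "i = 1" | j where "i = Suc (Suc j)" by (metis One_nat_def not0_implies_Suc)
    then show ?thesis
    proof cases
      case 1
      have "c \<in> rel_boundaries 0 {v} b" if "c \<in> rel_cycles 0 {v} b" for c
      proof -
        have c: "c \<in> supported (basis b 0)" using that by (simp add: rel_cycle_iff)
        \<comment> \<open>Here \<open>u\<close> matches the augmentation of \<open>c\<close> from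
          the lower degree, which is possible since \<open>\<not> V b\<close> forces
          \<open>\<not> V ?b\<close>. If \<open>V b\<close> holds, zero will do.\<close>
        obtain u where u: "u \<in> supported (basis ?b 0)" "V b \<or> eps (c - u) = 0"
        proof (cases "V b")
          case True
          then show ?thesis using that[OF zero_supported] by simp
        next
          case False
          then have "\<not> V ?b" using V_mono lower_le by blast
          then obtain w where w: "w \<in> supported (basis ?b 0)" "eps w \<noteq> 0" using eps_surj by blast
          have "eps (c - (\<lambda>p. eps c / eps w * w p)) = 0"
            unfolding eps_diff eps_scale using w(2) by simp
          then show ?thesis using that[OF supported_scale[OF w(1)]] by blast
        qed
        have "c - u \<in> {c \<in> supported (basis b 0). V b \<or> eps c = 0}"
          using c sub[OF u(1)] u(2) by (auto intro!: supported_diff)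
        then obtain y where y: "y \<in> supported (basis b 1)" "c - u = d 0 y"
          unfolding exact_eps by auto
        from y(2) have "c = d 0 y + u" by (metis diff_add_cancel)
        then show ?thesis using bound[OF c u(1), of y] y(1) by simp
      qed
      then show ?thesis unfolding 1 by (rule degree_bound_exact)
    next
      case 2
      let ?Z = "rel_cycles 1 {v} b"
      have Z: "c \<in> supported (basis b 1)" "d 0 c \<in> supported (basis ?b 0)" if "c \<in> ?Z" for c
        using that lb by (auto simp: rel_cycle_iff)
      \<comment> \<open>The scalar \<open>eps (d 0 c)\<close> is the only obstruction to being a
        relative boundary, which limits the homology to dimension 1. It vanishes unless
        \<open>V b\<close> holds.\<close>
      have lift: "c \<in> rel_boundaries 1 {v} b" if c: "c \<in> ?Z" and "V ?b \<or> eps (d 0 c) = 0" for c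
      proof -
        have "d 0 c \<in> {c \<in> supported (basis ?b 0). V ?b \<or> eps c = 0}"
          using that Z by auto
        then obtain u where u: "u \<in> supported (basis ?b 1)" "d 0 c = d 0 u"
          unfolding exact_eps by auto
        then show ?thesis using kernel[of c 0 u] Z(1)[OF c] by simp
      qed
      show ?thesis
      proof (cases "V b \<and> \<not> V ?b")
        case False
        have "c \<in> rel_boundaries 1 {v} b" if c: "c \<in> ?Z" for c
        proof (rule lift[OF c])
          have "V b \<or> eps (d 0 c) = 0" using exact_eps[of b] Z(1)[OF c] by blast
          then show "V ?b \<or> eps (d 0 c) = 0" using False by blast
        qed
        then show ?thesis unfolding 2 by (rule degree_bound_exact)
      next
        case True
        show ?thesis
        proof (cases "\<exists>z\<in>?Z. eps (d 0 z) \<noteq> 0")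
          case False
          then show ?thesis unfolding 2 using lift by (intro degree_bound_exact) blast
        next
          case ex: True
          then obtain z where z: "z \<in> ?Z" "eps (d 0 z) \<noteq> 0" by blast
          have "c \<in> fun_space.span ({z} \<union> rel_boundaries 1 {v} b)" if c: "c \<in> ?Z" for c
          proof -
            let ?m = "eps (d 0 c) / eps (d 0 z)"
            have "c - (\<lambda>p. ?m * z p) \<in> ?Z"
              using c z(1) subspace_rel_cycles fun_space.subspace_diff fun_space.subspace_scale by blast
            moreover have "eps (d 0 (c - (\<lambda>p. ?m * z p))) = 0"
            proof -
              have "eps (d 0 (c - (\<lambda>p. ?m * z p))) = eps (d 0 c) - ?m * eps (d 0 z)"
                by (simp only: d_diff d_scale eps_diff eps_scale)
              also have "\<dots> = 0" using z(2) by simp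
              finally show ?thesis .
            qed
            ultimately have "c - (\<lambda>p. ?m * z p) \<in> rel_boundaries 1 {v} b"
              by (intro lift disjI2)
            then have "c - (\<lambda>p. ?m * z p) \<in> fun_space.span (rel_boundaries 1 {v} b)"
              by (rule fun_space.span_base)
            then show ?thesis
              unfolding insert_is_Un[symmetric] fun_space.span_breakdown_eq by (rule exI[of _ ?m])
          qed
          then have "?Z \<subseteq> fun_space.span ({z} \<union> rel_boundaries 1 {v} b)" by (rule subsetI)
          then have "degree_bound 1 {v} b 1"
            unfolding degree_bound_def by (intro exI[of _ "{z}"] conjI) simp_all
          then show ?thesis using True 2 by simp
        qed
      qed
    next
      case (3 j)
      have "c \<in> rel_boundaries i {v} b" if "c \<in> rel_cycles i {v} b" for c
      proof -
        have c: "c \<in> supported (basis b (Suc (Suc j)))" "d (Suc j) c \<in> supported (basis ?b (Suc j))"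
          using that 3 lb by (auto simp: rel_cycle_iff)
        have "d (Suc j) c \<in> {c \<in> supported (basis ?b (Suc j)). d j c = (\<lambda>_. 0)}"
          using c bd_d[OF c(1)] by simp
        then obtain u where u: "u \<in> supported (basis ?b (Suc (Suc j)))" "d (Suc j) c = d (Suc j) u"
          unfolding exact by auto
        then show ?thesis using kernel[OF c(1) u] 3 by simp
      qed
      then show ?thesis by (rule degree_bound_exact)
    qed
  qed
  then show ?thesis by (simp add: hom_bound_def)
qed

text \<open>Starting from \<open>{v}\<close> and adjoining \<open>J - {v}\<close>, each term of the
  sum over subsets is 0 or 1, so the sum is a count. The freedom in choosing \<open>v\<close> is
  exploited in the multipartite case.\<close>

lemma hom_bound_card:
  assumes "finite J" "v \<in> J" "\<And>x. x \<in> J \<Longrightarrow> b x > 0"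
  shows "hom_bound J b (card {\<tau>. \<tau> \<subseteq> J - {v} \<and> V (lower b \<tau>) \<and> \<not> V (lower b (insert v \<tau>))})"
proof -
  let ?f = "\<lambda>\<tau>. if V (lower b \<tau>) \<and> \<not> V (lower b (insert v \<tau>)) then 1 else (0::nat)"
  have "hom_bound ({v} \<union> (J - {v})) b (sum ?f (Pow (J - {v})))"
  proof (rule hom_bound_Un)
    fix \<tau> assume "\<tau> \<subseteq> J - {v}"
    then have "lower b \<tau> v > 0" "lower (lower b \<tau>) {v} = lower b (insert v \<tau>)"
      using assms by (auto simp: lower_def fun_eq_iff)
    then show "hom_bound {v} (lower b \<tau>) (?f \<tau>)"
      using hom_bound_singleton[of "lower b \<tau>" v] by simp
  qed (use assms in auto)
  moreover have "{v} \<union> (J - {v}) = J" using assms by auto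
  moreover have "sum ?f (Pow (J - {v})) =
      card {\<tau>. \<tau> \<subseteq> J - {v} \<and> V (lower b \<tau>) \<and> \<not> V (lower b (insert v \<tau>))}"
    using assms(1) by (simp add: sum.If_cases) (rule arg_cong[of _ _ card], auto)
  ultimately show ?thesis by simp
qed

section \<open>Counting with representatives of the parts\<close>

lemma hom_bound_multipartite:
  fixes a :: "'v \<Rightarrow> nat" and part :: "'v \<Rightarrow> 'p"
  assumes fin: "finite {x. a x > 0}" and ne: "{x. a x > 0} \<noteq> {}"
    and V_iff: "\<And>b. V b \<longleftrightarrow> (\<exists>x y. b x > 0 \<and> b y > 0 \<and> part x \<noteq> part y)"
  shows "hom_bound {x. a x > 0} a (card (part ` {x. a x > 0}) - 1)"
proof -
  let ?S = "{x. a x > 0}"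
  define rep where "rep q = (SOME x. x \<in> ?S \<and> part x = q)" for q
  have rep: "rep (part x) \<in> ?S" "part (rep (part x)) = part x" if "x \<in> ?S" for x
    using that someI[of "\<lambda>y. y \<in> ?S \<and> part y = part x" x] by (auto simp: rep_def)
  define J where "J = rep ` part ` ?S"
  have rep_part: "rep (part x) = x" if "x \<in> J" for x
    using rep that by (auto simp: J_def)
  have J: "J \<subseteq> ?S" "finite J" using rep fin by (auto simp: J_def)
  have cardJ: "card J \<le> card (part ` ?S)" unfolding J_def using fin by (intro card_image_le) auto
  let ?T = "?S - J"
  \<comment> \<open>A summand with \<tau> different from \<open>?T\<close> vanishes: a variable
    outside \<open>J\<close> then survives beside the representative of its part.\<close>
  let ?f = "\<lambda>\<tau>. if \<tau> = ?T then card J - 1 else 0"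
  have "hom_bound (J \<union> ?T) a (sum ?f (Pow ?T))"
  proof (rule hom_bound_Un)
    fix \<tau> assume \<tau>: "\<tau> \<subseteq> ?T"
    let ?c = "lower a \<tau>"
    have cJ: "?c x = a x" "?c x > 0" if "x \<in> J" for x
      using that J \<tau> by (auto simp: lower_def)
    show "hom_bound J ?c (?f \<tau>)"
    proof (cases "\<exists>u. ?c u > (if u \<in> J then 1 else 0)")
      case True
      then obtain u where u: "?c u > (if u \<in> J then 1 else 0)" by blast
      then have uS: "u \<in> ?S" by (auto simp: lower_def split: if_splits)
      define w where "w = rep (part u)"
      have w: "w \<in> J" "part w = part u" using uS rep by (auto simp: w_def J_def)
      have "V (lower ?c (insert w \<tau>'))" if \<tau>': "\<tau>' \<subseteq> J - {w}" and V: "V (lower ?c \<tau>')" for \<tau>'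
      proof -
        let ?e = "lower ?c (insert w \<tau>')"
        \<comment> \<open>If \<open>u\<close> is \<open>w\<close>, its exponent was at least 2
          before lowering; if \<open>u\<close> is outside \<open>J\<close>, it is not
          lowered.\<close>
        have "?e u > 0"
        proof (cases "u \<in> J")
          case True
          then have "u = w" using rep_part by (simp add: w_def)
          then show ?thesis using u True by (auto simp: lower_def)
        next
          case False
          then show ?thesis using u w \<tau>' by (auto simp: lower_def)
        qed
        moreover have "?e x = lower ?c \<tau>' x" if "x \<noteq> w" for x using that by (auto simp: lower_def)
        \<comment> \<open>A witness equal to \<open>w\<close> is traded for \<open>u\<close>, which
          lies in the same part.\<close>
        ultimately have pos: "?e (if x = w then u else x) > 0" if "lower ?c \<tau>' x > 0" for x
          using that by simp
        obtain x y where "lower ?c \<tau>' x > 0" "lower ?c \<tau>' y > 0" "part x \<noteq> part y"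
          using V by (auto simp: V_iff)
        then show ?thesis using w(2) pos[of x] pos[of y] unfolding V_iff
          by (intro exI[of _ "if x = w then u else x"] exI[of _ "if y = w then u else y"]) auto
      qed
      \<comment> \<open>Lowering \<open>w\<close> never changes which parts are met, because \<open>u\<close> remains in its part.\<close>
      then have none: "{\<tau>'. \<tau>' \<subseteq> J - {w} \<and> V (lower ?c \<tau>') \<and> \<not> V (lower ?c (insert w \<tau>'))} = {}" by blast
      have "hom_bound J ?c 0"
        using hom_bound_card[OF J(2) w(1), of ?c, OF cJ(2)] unfolding none card.empty .
      then show ?thesis by (rule hom_bound_mono) simp
    next
      case False
      then have c_eq: "?c x = (if x \<in> J then 1 else 0)" for x
      proof -
        have "?c x \<le> (if x \<in> J then 1 else 0)" using False by (meson not_le)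
        then show ?thesis using cJ(2)[of x] by (cases "x \<in> J") auto
      qed
      have "x \<in> \<tau>" if "x \<in> ?T" for x
        using c_eq[of x] that by (auto simp: lower_def split: if_splits)
      then have T: "\<tau> = ?T" using \<tau> by blast
      obtain w where w: "w \<in> J" using ne by (auto simp: J_def)
      let ?A = "{\<tau>'. \<tau>' \<subseteq> J - {w} \<and> V (lower ?c \<tau>') \<and> \<not> V (lower ?c (insert w \<tau>'))}"
      \<comment> \<open>Membership in \<open>?A\<close> means that \<open>J - \<tau>'\<close> meets
        two parts, but only one part at most once \<open>w\<close> is removed. So \<tau>' omits
        exactly one representative \<open>x\<close> other than \<open>w\<close>.\<close>
      have "?A \<subseteq> (\<lambda>x. J - {w, x}) ` (J - {w})"
      proof
        fix \<tau>' assume "\<tau>' \<in> ?A"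
        then have \<tau>': "\<tau>' \<subseteq> J - {w}" "V (lower ?c \<tau>')" "\<not> V (lower ?c (insert w \<tau>'))" by auto
        have pos: "lower ?c X x > 0 \<longleftrightarrow> x \<in> J - X" for X x
          using c_eq[of x] by (auto simp: lower_def split: if_splits)
        obtain x where x: "x \<in> J - \<tau>'" "x \<noteq> w"
          using \<tau>'(2) unfolding V_iff pos by metis
        have "y = x" if "y \<in> J - insert w \<tau>'" for y
        proof -
          have "part y = part x" using \<tau>'(3) that x unfolding V_iff pos by auto
          then show ?thesis using rep_part that x(1) by (metis DiffD1)
        qed
        then have "\<tau>' = J - {w, x}" using \<tau>'(1) x by auto
        then show "\<tau>' \<in> (\<lambda>x. J - {w, x}) ` (J - {w})" using x by blast
      qed
      then have "card ?A \<le> card (J - {w})" using J(2) by (meson surj_card_le finite_Diff)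
      also have "\<dots> = card J - 1" using w by simp
      finally have "hom_bound J ?c (card J - 1)"
        using hom_bound_mono[OF hom_bound_card[OF J(2) w, of ?c]] cJ(2) by blast
      then show ?thesis using T by simp
    qed
  qed (use fin in auto)
  moreover have "sum ?f (Pow ?T) = card J - 1"
    using fin by (simp add: sum.delta')
  moreover have "J \<union> ?T = ?S" using J by auto
  ultimately show ?thesis using hom_bound_mono cardJ diff_le_mono by metis
qed

text \<open>
  By minimality the degree-\<open>a\<close> basis vectors are relative cycles for the full set of variables
  dividing \<open>a\<close>, while relative boundaries have vanishing coordinates in degree \<open>a\<close>.
\<close>

lemma card_basis_le:
  assumes minimal: "\<And>i p q. p < r i \<Longrightarrow> q < r (Suc i) \<Longrightarrow> D i p q \<noteq> 0 \<Longrightarrow> sh i p \<noteq> sh (Suc i) q"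
    and bound: "degree_bound i {x. a x > 0} a n"
  shows "card {p. p < r i \<and> sh i p = a} \<le> n"
proof -
  let ?P = "{p. p < r i \<and> sh i p = a}"
  let ?S = "{x. a x > 0}"
  define e where "e p = (\<lambda>q. if q = p then 1 else (0::'k))" for p :: nat
  define proj where "proj c = (\<lambda>q. if q \<in> ?P then c q else (0::'k))" for c
  obtain S where S: "finite S" "card S \<le> n" "rel_cycles i ?S a \<subseteq> fun_space.span (S \<union> rel_boundaries i ?S a)"
    using bound by (auto simp: degree_bound_def)
  have strict: "p \<in> lower_basis ?S a i" if "p < r i" "sh i p \<le> a" "sh i p \<noteq> a" for p i
  proof -
    obtain v where "sh i p v < a v"
      using \<open>sh i p \<le> a\<close> \<open>sh i p \<noteq> a\<close> by (metis antisym le_fun_def not_le)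
    then have "v \<in> ?S" "sh i p v < a v" by auto
    then show ?thesis using that unfolding lower_basis_def basis_def
      by (intro CollectI conjI bexI[of _ v]) auto
  qed
  have e_cycle: "e p \<in> rel_cycles i ?S a" if p: "p \<in> ?P" for p
  proof -
    have "bd i (e p) \<in> supported (lower_basis ?S a (i - 1))"
    proof (cases i)
      case (Suc j)
      have "d j (e p) = (\<lambda>q. if q < r j then D j q p else 0)"
        using p Suc by (auto simp: d_def e_def fun_eq_iff sum.delta' if_distrib cong: if_cong)
      moreover have "q \<in> lower_basis ?S a j" if "q < r j" "D j q p \<noteq> 0" for q
        using that p Suc strict sh_mono[of q j p] minimal[of q j p] by auto
      ultimately show ?thesis using Suc by (auto simp: supported_def)
    qed (simp add: supported_def)
    then show ?thesis using p by (auto simp: rel_cycle_iff supported_def e_def basis_def)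
  qed
  have proj_boundary: "proj t = 0" if t: "t \<in> rel_boundaries i ?S a" for t
  proof -
    obtain y u where yu: "t = d i y + u" "y \<in> supported (basis a (Suc i))"
        "u \<in> supported (lower_basis ?S a i)"
      using t unfolding rel_boundaries_def by blast
    have "t p = 0" if p: "p \<in> ?P" for p
    proof -
      have "D i p q * y q = 0" if q: "q < r (Suc i)" for q
      proof (rule ccontr)
        assume *: "D i p q * y q \<noteq> 0"
        then have "sh (Suc i) q \<le> a" using yu(2) by (auto simp: supported_def basis_def)
        moreover have "a \<le> sh (Suc i) q" "a \<noteq> sh (Suc i) q"
          using * p q sh_mono[of p i q] minimal[of p i q] by auto
        ultimately show False by auto
      qed
      then have "d i y p = 0" by (auto simp: d_def intro!: sum.neutral)
      moreover have "u p = 0" using p yu(3) by (auto simp: supported_def lower_basis_def)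
      ultimately show ?thesis using yu(1) by simp
    qed
    then show ?thesis by (auto simp: proj_def fun_eq_iff)
  qed
  \<comment> \<open>Since \<open>proj\<close> kills relative boundaries and fixes the unit vectors
    of degree \<open>a\<close>, the images of \<open>S\<close> span these vectors.\<close>
  have "e ` ?P \<subseteq> fun_space.span (proj ` S)"
  proof
    fix x assume "x \<in> e ` ?P"
    then obtain p where p: "p \<in> ?P" "x = e p" by blast
    have "e p \<in> fun_space.span (S \<union> rel_boundaries i ?S a)" using e_cycle[OF p(1)] S(3) by blast
    moreover have "fun_space.span (S \<union> rel_boundaries i ?S a)
        \<subseteq> {c. proj c \<in> fun_space.span (proj ` S)}"
    proof (rule fun_space.span_minimal)
      show "S \<union> rel_boundaries i ?S a \<subseteq> {c. proj c \<in> fun_space.span (proj ` S)}"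
        using proj_boundary by (auto intro: fun_space.span_base simp: fun_space.span_zero)
      have "proj 0 = 0" "\<And>c c'. proj (c + c') = proj c + proj c'"
          "\<And>l c. proj (\<lambda>p. l * c p) = (\<lambda>p. l * proj c p)"
        by (auto simp: proj_def fun_eq_iff)
      then show "fun_space.subspace {c. proj c \<in> fun_space.span (proj ` S)}"
        by (auto simp: fun_space.subspace_def fun_space.span_zero
            intro: fun_space.span_add fun_space.span_scale)
    qed
    moreover have "proj (e p) = e p" using p by (auto simp: proj_def e_def fun_eq_iff)
    ultimately show "x \<in> fun_space.span (proj ` S)" using p(2) by auto
  qed
  moreover have "inj e" by (auto simp: inj_def e_def fun_eq_iff split: if_splits)
  moreover have "fun_space.independent (e ` ?P)"
    unfolding fun_space.dependent_def
  proof
    assume "\<exists>x\<in>e ` ?P. x \<in> fun_space.span (e ` ?P - {x})"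
    then obtain p where p: "e p \<in> fun_space.span (e ` ?P - {e p})" by blast
    have "fun_space.span (e ` ?P - {e p}) \<subseteq> {c. c p = 0}"
      by (rule fun_space.span_minimal) (auto simp: e_def fun_space.subspace_def)
    then show False using p by (auto simp: e_def)
  qed
  ultimately have "card (e ` ?P) \<le> card (proj ` S)"
    using fun_space.independent_span_bound[of "proj ` S" "e ` ?P"] S(1) by auto
  also have "\<dots> \<le> n" using card_image_le[OF S(1), of proj] S(2) by linarith
  finally show ?thesis using \<open>inj e\<close> by (simp add: card_image inj_on_subset)
qed

text \<open>With no variables to divide by, the homology is that of the strand itself, which is
  exact in positive degrees. This covers \<open>a = 0\<close>, whose support is empty.\<close>

lemma degree_bound_empty: "degree_bound (Suc i) {} b 0"
proof (rule degree_bound_exact)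
  fix c assume "c \<in> rel_cycles (Suc i) {} b"
  then have "c \<in> {c \<in> supported (basis b (Suc i)). d i c = (\<lambda>_. 0)}"
    by (auto simp: rel_cycle_iff lower_basis_def supported_def fun_eq_iff)
  then obtain y where "y \<in> supported (basis b (Suc (Suc i)))" "c = d (Suc i) y"
    unfolding exact by auto
  then show "c \<in> rel_boundaries (Suc i) {} b"
    using rel_boundaryI[OF _ zero_supported, of y b "Suc i" "{}"] by (simp add: plus_fun_def)
qed

end

section \<open>Strands of a minimal resolution\<close>

locale minimal_edge_resolution =
  fixes F :: "('v::finite, 'k::field) free_complex" and E :: "'v set set"
  assumes res: "minimal_multigraded_resolution F (edge_ideal E)"
begin

abbreviation deg :: "nat \<Rightarrow> nat \<Rightarrow> 'v \<Rightarrow> nat" where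
  "deg i p \<equiv> poly_mapping.lookup (shift F i p)"

definition scalar :: "nat \<Rightarrow> nat \<Rightarrow> nat \<Rightarrow> 'k" where
  "scalar i p q = poly_mapping.lookup (dmat F i p q) (shift F (Suc i) q - shift F i p)"

definition aug_scalar :: "nat \<Rightarrow> 'k" where
  "aug_scalar p = poly_mapping.lookup (aug F p) (shift F 0 p)"

sublocale multigraded_strands "rnk F" deg scalar aug_scalar .

text \<open>Multigradedness allows one monomial per entry. For incomparable shifts it allows none;
  the scalar is then zero and the truncated difference harmless.\<close>

lemma dmat_eq:
  assumes "p < rnk F i" "q < rnk F (Suc i)"
  shows "dmat F i p q = Poly_Mapping.single (shift F (Suc i) q - shift F i p) (scalar i p q)"
proof (rule poly_mapping_eqI)
  fix m
  have "m = shift F (Suc i) q - shift F i p" if "m \<in> Poly_Mapping.keys (dmat F i p q)"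
  proof -
    have "m + shift F i p = shift F (Suc i) q"
      using res that assms by (auto simp: minimal_multigraded_resolution_def multigraded_def)
    then show ?thesis by (metis add_diff_cancel_right')
  qed
  then show "poly_mapping.lookup (dmat F i p q) m =
      poly_mapping.lookup (Poly_Mapping.single (shift F (Suc i) q - shift F i p) (scalar i p q)) m"
    by (auto simp: scalar_def lookup_single when_def in_keys_iff)
qed

lemma scalar_shift:
  assumes "p < rnk F i" "q < rnk F (Suc i)" "scalar i p q \<noteq> 0"
  shows "shift F (Suc i) q = (shift F (Suc i) q - shift F i p) + shift F i p"
proof -
  have "shift F (Suc i) q - shift F i p \<in> Poly_Mapping.keys (dmat F i p q)"
    using assms(3) by (auto simp: scalar_def in_keys_iff)
  then show ?thesis
    using res assms(1,2) unfolding minimal_multigraded_resolution_def multigraded_def by metis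
qed

lemma scalar_mono:
  assumes "p < rnk F i" "q < rnk F (Suc i)" "scalar i p q \<noteq> 0"
  shows "deg i p \<le> deg (Suc i) q"
  by (subst scalar_shift[OF assms]) (simp add: lookup_add le_fun_def)

lemma scalar_minimal:
  assumes "p < rnk F i" "q < rnk F (Suc i)" "scalar i p q \<noteq> 0"
  shows "deg i p \<noteq> deg (Suc i) q"
proof
  assume "deg i p = deg (Suc i) q"
  then have "shift F i p = shift F (Suc i) q" by (intro poly_mapping_eqI) simp
  moreover have "poly_mapping.lookup (dmat F i p q) 0 = 0"
    using res assms(1,2) lookup_irrelevant_ideal
    unfolding minimal_multigraded_resolution_def minimal_complex_def by blast
  ultimately show False using assms(3) by (simp add: scalar_def)
qed

lemma aug_eq:
  assumes "p < rnk F 0"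
  shows "aug F p = Poly_Mapping.single (shift F 0 p) (aug_scalar p)"
proof (rule poly_mapping_eqI)
  fix m
  have "Poly_Mapping.keys (aug F p) \<subseteq> {shift F 0 p}"
    using res assms by (auto simp: minimal_multigraded_resolution_def multigraded_def)
  then show "poly_mapping.lookup (aug F p) m =
      poly_mapping.lookup (Poly_Mapping.single (shift F 0 p) (aug_scalar p)) m"
    by (auto simp: aug_scalar_def lookup_single when_def in_keys_iff)
qed

section \<open>Passage between polynomial chains and their strands\<close>

definition strand :: "'v mon \<Rightarrow> nat \<Rightarrow> (nat \<Rightarrow> ('v, 'k) mpoly) \<Rightarrow> nat \<Rightarrow> 'k" where
  "strand B i c = (\<lambda>p. if deg i p \<le> poly_mapping.lookup B
     then poly_mapping.lookup (c p) (B - shift F i p) else 0)"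

text \<open>A right inverse of \<open>strand B i\<close> on supported vectors, with values the
  chains homogeneous of degree \<open>B\<close>.\<close>

definition homogenize :: "'v mon \<Rightarrow> nat \<Rightarrow> (nat \<Rightarrow> 'k) \<Rightarrow> nat \<Rightarrow> ('v, 'k) mpoly" where
  "homogenize B i c = (\<lambda>p. if p \<in> basis (poly_mapping.lookup B) i
     then Poly_Mapping.single (B - shift F i p) (c p) else 0)"

lemma strand_supported:
  "c \<in> chains F i \<Longrightarrow> strand B i c \<in> supported (basis (poly_mapping.lookup B) i)"
  by (auto simp: strand_def supported_def basis_def chains_def)

lemma homogenize_chain: "homogenize B i c \<in> chains F i"
  by (auto simp: homogenize_def chains_def basis_def)

lemma diff_add_mon: "poly_mapping.lookup m \<le> poly_mapping.lookup B \<Longrightarrow> (B - m) + m = (B :: 'v mon)"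
  by (intro poly_mapping_eqI) (simp add: lookup_add lookup_minus le_fun_def)

lemma strand_homogenize:
  assumes "c \<in> supported (basis (poly_mapping.lookup B) i)"
  shows "strand B' i (homogenize B i c) = (if B' = B then c else (\<lambda>_. 0))"
proof -
  have "B - shift F i p \<noteq> B' - shift F i p"
    if "B' \<noteq> B" "deg i p \<le> poly_mapping.lookup B" "deg i p \<le> poly_mapping.lookup B'" for p
    using that diff_add_mon by metis
  then show ?thesis using assms
    by (auto simp: strand_def homogenize_def basis_def supported_def lookup_single when_def fun_eq_iff)
qed

lemma strand_zero: "strand B i (\<lambda>_. 0) = (\<lambda>_. 0)"
  by (simp add: strand_def fun_eq_iff)

lemma chain_eq_zeroI:
  assumes "\<And>B. strand B i c = (\<lambda>_. 0)"
  shows "c = (\<lambda>_. 0)"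
proof (rule ext, rule poly_mapping_eqI)
  fix p t
  have "deg i p \<le> poly_mapping.lookup (t + shift F i p)" by (simp add: lookup_add le_fun_def)
  then have "poly_mapping.lookup (c p) t = strand (t + shift F i p) i c p" by (simp add: strand_def)
  then show "poly_mapping.lookup (c p) t = poly_mapping.lookup 0 t" using assms by simp
qed

text \<open>The differential preserves total degree, so taking degree-\<open>B\<close> coefficients
  turns its monomial matrix into the scalar one.\<close>

lemma strand_boundary: "strand B i (boundary F i c) = d i (strand B (Suc i) c)"
proof
  fix p
  show "strand B i (boundary F i c) p = d i (strand B (Suc i) c) p"
  proof (cases "p < rnk F i")
    case p: True
    have coeff: "(if deg i p \<le> poly_mapping.lookup B
        then poly_mapping.lookup (dmat F i p q * c q) (B - shift F i p) else 0)
        = scalar i p q * strand B (Suc i) c q" if q: "q < rnk F (Suc i)" for q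
    proof (cases "scalar i p q = 0")
      case True
      then show ?thesis using dmat_eq[OF p q] by simp
    next
      case False
      note eq = scalar_shift[OF p q False]
      let ?m = "shift F (Suc i) q - shift F i p"
      have lookup_eq: "deg (Suc i) q v = poly_mapping.lookup ?m v + deg i p v" for v
        using arg_cong[OF eq, of "\<lambda>m. poly_mapping.lookup m v"] by (simp add: lookup_add)
      have 1: "deg (Suc i) q \<le> poly_mapping.lookup B \<longleftrightarrow> deg i p \<le> poly_mapping.lookup B \<and>
          poly_mapping.lookup ?m \<le> poly_mapping.lookup (B - shift F i p)"
        unfolding le_fun_def lookup_eq lookup_minus[of B]
        by (metis add_leE le_diff_conv2)
      have 2: "B - shift F i p - ?m = B - shift F (Suc i) q"
        by (subst (2) eq) (simp add: diff_diff_add add.commute)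
      show ?thesis
        unfolding dmat_eq[OF p q] lookup_single_times strand_def 2 using 1 by auto
    qed
    have "strand B i (boundary F i c) p = (\<Sum>q<rnk F (Suc i). if deg i p \<le> poly_mapping.lookup B
        then poly_mapping.lookup (dmat F i p q * c q) (B - shift F i p) else 0)"
      using p by (simp add: strand_def boundary_def lookup_sum)
    also have "\<dots> = d i (strand B (Suc i) c) p"
      using p coeff by (simp add: d_def)
    finally show ?thesis .
  qed (simp add: strand_def boundary_def d_def)
qed

lemma lookup_augment: "poly_mapping.lookup (augment F c) B = eps (strand B 0 c)"
  unfolding augment_def eps_def lookup_sum
  by (intro sum.cong refl) (simp add: aug_eq lookup_single_times strand_def)

lemma lookup_surj: "\<exists>B :: 'v mon. b = poly_mapping.lookup B"
  by (metis Abs_poly_mapping_inverse finite mem_Collect_eq)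

text \<open>A cycle of a strand is homogenized to a cycle of \<open>F\<close>, bounded there, and
  the bounding chain is cut back to the strand.\<close>

sublocale exact_strands "rnk F" deg scalar aug_scalar "edge_degree E"
proof
  have exactF: "{c \<in> chains F (Suc i). boundary F i c = (\<lambda>_. 0)} =
      boundary F (Suc i) ` chains F (Suc (Suc i))" for i
    using res unfolding minimal_multigraded_resolution_def resolves_quotient_def by blast
  have exact0: "{c \<in> chains F 0. augment F c \<in> edge_ideal E} = boundary F 0 ` chains F 1"
    using res unfolding minimal_multigraded_resolution_def resolves_quotient_def by blast
  show "deg i p \<le> deg (Suc i) q"
    if "p < rnk F i" "q < rnk F (Suc i)" "scalar i p q \<noteq> 0" for i p q
    using scalar_mono[OF that] .
  show "edge_degree E b'" if "edge_degree E b" "b \<le> b'" for b b'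
    using edge_degree_mono[OF that] .
  show "{c \<in> supported (basis b (Suc i)). d i c = (\<lambda>_. 0)}
      = d (Suc i) ` supported (basis b (Suc (Suc i)))" for i b
  proof -
    obtain B :: "'v mon" where B: "b = poly_mapping.lookup B" using lookup_surj by blast
    show ?thesis
    proof safe
      fix c assume c: "c \<in> supported (basis b (Suc i))" "d i c = (\<lambda>_. 0)"
      have "d i (\<lambda>_. 0) = (\<lambda>_. 0)" by (simp add: d_def fun_eq_iff)
      then have "boundary F i (homogenize B (Suc i) c) = (\<lambda>_. 0)"
        using c B by (intro chain_eq_zeroI[of i]) (simp add: strand_boundary strand_homogenize)
      then obtain y where y: "y \<in> chains F (Suc (Suc i))"
          "homogenize B (Suc i) c = boundary F (Suc i) y"
        using exactF[of i] homogenize_chain[of B "Suc i" c] by blast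
      have "c = strand B (Suc i) (homogenize B (Suc i) c)" using c B by (simp add: strand_homogenize)
      also have "\<dots> = d (Suc i) (strand B (Suc (Suc i)) y)" by (simp add: y strand_boundary)
      finally show "c \<in> d (Suc i) ` supported (basis b (Suc (Suc i)))"
        using strand_supported[OF y(1)] B by blast
    next
      fix y :: "nat \<Rightarrow> 'k" assume y: "y \<in> supported (basis b (Suc (Suc i)))"
      let ?c = "boundary F (Suc i) (homogenize B (Suc (Suc i)) y)"
      have s: "strand B (Suc i) ?c = d (Suc i) y" using y B by (simp add: strand_boundary strand_homogenize)
      have c: "?c \<in> chains F (Suc i)" "boundary F i ?c = (\<lambda>_. 0)"
        using exactF[of i] homogenize_chain[of B "Suc (Suc i)" y] by blast+
      show "d (Suc i) y \<in> supported (basis b (Suc i))" using strand_supported[OF c(1), of B] s B by simp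
      show "d i (d (Suc i) y) = (\<lambda>_. 0)"
        using strand_boundary[of B i ?c] c(2) s by (simp add: strand_zero)
    qed
  qed
  show "{c \<in> supported (basis b 0). edge_degree E b \<or> eps c = 0} = d 0 ` supported (basis b 1)" for b
  proof -
    obtain B :: "'v mon" where B: "b = poly_mapping.lookup B" using lookup_surj by blast
    show ?thesis
    proof (intro set_eqI iffI)
      fix c assume c: "c \<in> {c \<in> supported (basis b 0). edge_degree E b \<or> eps c = 0}"
      \<comment> \<open>The augmentation of the homogenized chain is concentrated in degree
        \<open>B\<close>, where it is either a monomial of the ideal or zero.\<close>
      have "edge_degree E (poly_mapping.lookup m)"
        if "m \<in> Poly_Mapping.keys (augment F (homogenize B 0 c))" for m
        using that c B by (auto simp: in_keys_iff lookup_augment strand_homogenize eps_def split: if_splits)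
      then have "augment F (homogenize B 0 c) \<in> edge_ideal E" by (simp add: mem_edge_ideal_iff)
      then obtain y where y: "y \<in> chains F 1" "homogenize B 0 c = boundary F 0 y"
        using exact0 homogenize_chain[of B 0 c] by blast
      have "c = strand B 0 (homogenize B 0 c)" using c B by (simp add: strand_homogenize)
      also have "\<dots> = d 0 (strand B 1 y)" by (simp add: y strand_boundary)
      finally show "c \<in> d 0 ` supported (basis b 1)"
        using strand_supported[OF y(1)] B by blast
    next
      fix c assume "c \<in> d 0 ` supported (basis b 1)"
      then obtain y where y: "y \<in> supported (basis b 1)" "c = d 0 y" by blast
      let ?c = "boundary F 0 (homogenize B 1 y)"
      have s: "strand B 0 ?c = c" using y B by (simp add: strand_boundary strand_homogenize)
      have c: "?c \<in> chains F 0" "augment F ?c \<in> edge_ideal E"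
        using exact0 homogenize_chain[of B 1 y] by blast+
      have "edge_degree E b \<or> eps c = 0"
        using c(2) s B by (auto simp: mem_edge_ideal_iff in_keys_iff lookup_augment)
      then show "c \<in> {c \<in> supported (basis b 0). edge_degree E b \<or> eps c = 0}"
        using strand_supported[OF c(1), of B] s B by simp
    qed
  qed
  show "\<exists>c \<in> supported (basis b 0). eps c \<noteq> 0" if b: "\<not> edge_degree E b" for b
  proof -
    obtain B :: "'v mon" where B: "b = poly_mapping.lookup B" using lookup_surj by blast
    \<comment> \<open>A lift of the monomial of degree \<open>B\<close>. The ideal has no
      coefficients there, so the lift has augmentation 1 in that degree.\<close>
    obtain c where c: "c \<in> chains F 0" "Poly_Mapping.single B 1 - augment F c \<in> edge_ideal E"
      using res unfolding minimal_multigraded_resolution_def resolves_quotient_def by blast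
    have "poly_mapping.lookup (Poly_Mapping.single B 1 - augment F c) B = 0"
      using c(2) b B by (auto simp: mem_edge_ideal_iff in_keys_iff)
    then have "eps (strand B 0 c) = 1" by (simp add: lookup_minus lookup_augment)
    then show ?thesis using strand_supported[OF c(1), of B] B by (intro bexI) auto
  qed
qed

section \<open>Betti numbers of complete multipartite graphs\<close>

lemma betti_le:
  fixes part :: "'v \<Rightarrow> 'p"
  assumes edges: "\<And>u v. {u, v} \<in> E \<longleftrightarrow> part u \<noteq> part v"
  shows "multigraded_betti F (Suc i) a \<le> card (range part) - 1"
proof -
  let ?S = "{x. poly_mapping.lookup a x > 0}"
  have edge_degree_iff: "edge_degree E b \<longleftrightarrow> (\<exists>x y. b x > 0 \<and> b y > 0 \<and> part x \<noteq> part y)" for b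
  proof -
    have "poly_mapping.lookup (Poly_Mapping.single u 1 + Poly_Mapping.single v 1) \<le> b \<longleftrightarrow> b u > 0 \<and> b v > 0"
      if "u \<noteq> v" for u v
    proof -
      have "poly_mapping.lookup (Poly_Mapping.single u 1 + Poly_Mapping.single v 1) =
          (\<lambda>x. if x = u \<or> x = v then 1 else (0::nat))"
        using that by (auto simp: lookup_add lookup_single when_def fun_eq_iff)
      then show ?thesis by (auto simp: le_fun_def Suc_le_eq)
    qed
    then show ?thesis unfolding edge_degree_def edges by metis
  qed
  have "degree_bound (Suc i) ?S (poly_mapping.lookup a) (card (range part) - 1)"
  proof (cases "?S = {}")
    case True
    show ?thesis unfolding True by (rule degree_bound_mono[OF degree_bound_empty le0])
  next
    case False
    have "card (part ` ?S) - 1 \<le> card (range part) - 1"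
      by (intro diff_le_mono card_mono) auto
    then show ?thesis
      using hom_bound_multipartite[OF _ False edge_degree_iff] degree_bound_mono
      unfolding hom_bound_def by (metis finite)
  qed
  from card_basis_le[OF scalar_minimal this]
  have "card {p. p < rnk F (Suc i) \<and> deg (Suc i) p = poly_mapping.lookup a} \<le> card (range part) - 1" .
  then show ?thesis by (simp add: multigraded_betti_def)
qed

end

theorem corollary4p5:
  fixes E :: "'v::finite set set"
    and F :: "('v, 'k::field) free_complex"
    and k i :: nat
    and a :: "'v \<Rightarrow>\<^sub>0 nat"
  assumes "complete_multipartite k E"
    and "minimal_multigraded_resolution F (edge_ideal E)"
    and "i \<ge> 1"
  shows "multigraded_betti F i a \<le> k - 1"
proof -
  interpret minimal_edge_resolution F E using assms(2) by unfold_locales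
  obtain P where P: "partition_on (UNIV :: 'v set) P" "card P = k"
      "E = {{u, v} | u v. \<exists>U\<in>P. \<exists>V\<in>P. u \<in> U \<and> v \<in> V \<and> U \<noteq> V}"
    using assms(1) by (auto simp: complete_multipartite_def)
  define part where "part u = (THE U. U \<in> P \<and> u \<in> U)" for u
  have ex1: "\<exists>!U. U \<in> P \<and> u \<in> U" for u
  proof -
    obtain U where U: "U \<in> P" "u \<in> U" using P(1) by (auto simp: partition_on_def)
    moreover have "W = U" if "W \<in> P" "u \<in> W" for W
      using P(1) U that unfolding partition_on_def disjoint_def by blast
    ultimately show ?thesis by blast
  qed
  have part: "part u \<in> P" "u \<in> part u" for u
    using theI'[OF ex1] by (auto simp: part_def)
  have part_eq: "U = part u" if "U \<in> P" "u \<in> U" for U u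
    using ex1 part that by metis
  have "{u, v} \<in> E \<longleftrightarrow> part u \<noteq> part v" for u v
  proof
    assume "{u, v} \<in> E"
    then obtain u' v' U V where uv: "{u, v} = {u', v'}" "U \<in> P" "V \<in> P" "u' \<in> U" "v' \<in> V" "U \<noteq> V"
      unfolding P(3) by blast
    have "part u' \<noteq> part v'"
      using part_eq[OF uv(2,4)] part_eq[OF uv(3,5)] uv(6) by simp
    then show "part u \<noteq> part v" using uv(1) by (auto simp: doubleton_eq_iff)
  next
    assume "part u \<noteq> part v"
    then show "{u, v} \<in> E" using part P(3) by blast
  qed
  then have "multigraded_betti F i a \<le> card (range part) - 1"
    using betti_le[of part "i - 1" a] assms(3) by simp
  also have "\<dots> \<le> k - 1"
    using part(1) P(2) by (intro diff_le_mono) (auto intro!: card_mono)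
  finally show ?thesis .
qed

end
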